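(* Let $i \geq 1$ and $n \geq 1$ be integers, and let $F_i, F_{i+1}, F_{i+2}$ denote the $i$-th, $(i+1)$-th and $(i+2)$-th Fibonacci numbers. Define integers $B'_1, C'_2, A'_3$ by \begin{itemize} \item $B'_1 \equiv (-1)^i n F_{i-2} \pmod{F_i}$ with $1 \leq B'_1 \leq F_i$; \item $C'_2 \equiv (-1)^i n F_{i} \pmod{F_{i+1}}$ with $1 \leq C'_2 \leq F_{i+1}$; \item $A'_3 \equiv (-1)^i n F_{i+1} \pmod{F_{i+2}}$ with $1 \leq A'_3 \leq F_{i+2}$, \end{itemize} and set \begin{align*} N_2 = {} & n(n+F_i+F_{i+1}+F_{i+2}) + F_{i+2}F_{i+1}B'_1\bigl(F_i+1-(B'_1-1)\bigr) + F_iF_{i+2}C'_2\bigl(F_{i+1}+1-(C'_2-1)\bigr) \\ & + F_{i+1}F_iA'_3\bigl(F_{i+2}+1-(F_{i+2}-1)(A'_3-1)\bigr). \end{align*} Then the number $N(F_i,F_{i+1},F_{i+2};n)$ of triples $(x,y,z)$ of non-negative integers satisfying $F_i x + F_{i+1} y + F_{i+2} z = n$ is $$N(F_i,F_{i+1},F_{i+2};n)=\frac{N_2}{2F_iF_{i+1}F_{i+2}}+\frac{(A'_3-1)(A'_3-2)}{2} - 2.$$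
   Context: Fibonacci numbers: $F_0=0$, $F_1=1$, $F_{k+1}=F_k+F_{k-1}$, extended to negative indices by the same recurrence (so $F_{-1}=1$). For $i=1$ the modulus $F_1=1$, so the value of $F_{-1}$ plays no role. *)

theory Defs
  imports "HOL-Number_Theory.Number_Theory"
begin

text \<open>Fibonacci numbers of negative index, with the index negated: \<open>fib_neg k\<close> is
  \<open>F\<^bsub>-k\<^esub>\<close>, computed by running the recurrence backwards, \<open>F\<^bsub>-(k+2)\<^esub> = F\<^bsub>-k\<^esub> - F\<^bsub>-(k+1)\<^esub>\<close>.\<close>

fun fib_neg :: "nat \<Rightarrow> int" where
  "fib_neg 0 = 0"
| "fib_neg (Suc 0) = 1"
| "fib_neg (Suc (Suc k)) = fib_neg k - fib_neg (Suc k)"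

definition fib_int :: "int \<Rightarrow> int" where
  "fib_int k = (if 0 \<le> k then int (fib (nat k)) else fib_neg (nat (- k)))"

lemma fib_int_of_nat [simp]: "fib_int (int k) = int (fib k)"
  by (simp add: fib_int_def)

lemma fib_int_minus_of_nat: "fib_int (- int k) = fib_neg k"
  by (cases "k = 0") (auto simp: fib_int_def)

lemma fib_int_rec: "fib_int (k + 1) = fib_int k + fib_int (k - 1)"
proof (cases "1 \<le> k")
  case True
  then obtain m where "k = int (Suc m)"
    by (metis Suc_le_D nat_int_comparison(3) of_nat_1 One_nat_def zero_le_imp_eq_int
        order_trans zero_le_one)
  then have "k + 1 = int (Suc (Suc m))" "k = int (Suc m)" "k - 1 = int m"
    by simp_all
  then show ?thesis
    by (simp only: fib_int_of_nat fib.simps of_nat_add)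
next
  case False
  show ?thesis
  proof (cases "k = 0")
    case True
    then show ?thesis by (simp add: fib_int_def)
  next
    case 2: False
    define m where "m = nat (- k - 1)"
    have "k + 1 = - int m" "k = - int (Suc m)" "k - 1 = - int (Suc (Suc m))"
      using False 2 by (simp_all add: m_def)
    then show ?thesis
      by (simp only: fib_int_minus_of_nat fib_neg.simps)
  qed
qed

definition num_solutions :: "nat \<Rightarrow> nat \<Rightarrow> nat \<Rightarrow> nat \<Rightarrow> nat" where
  "num_solutions a b c n = card {(x, y, z). a * x + b * y + c * z = n}"

lemma finite_solutions:
  fixes a b c n :: nat
  assumes "a > 0" "b > 0" "c > 0"
  shows "finite {(x, y, z). a * x + b * y + c * z = n}"
proof (rule finite_subset)
  have le: "x \<le> d * x" if "d > 0" for d x :: nat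
    using that by (cases d) simp_all
  have "x \<le> n \<and> y \<le> n \<and> z \<le> n" if "a * x + b * y + c * z = n" for x y z
    using le[OF assms(1), of x] le[OF assms(2), of y] le[OF assms(3), of z] that by linarith
  then show "{(x, y, z). a * x + b * y + c * z = n} \<subseteq> {..n} \<times> {..n} \<times> {..n}"
    by auto
qed simp

end

theory Submission
  imports Defs
begin

text \<open>Write \<open>a = F\<^sub>i\<close>, \<open>b = F\<^bsub>i+1\<^esub>\<close>, \<open>c = a + b\<close>. By Cassini's identity the three residues are the
  solutions of \<open>b B \<equiv> -n (mod a)\<close>, \<open>a C \<equiv> -n (mod b)\<close> and \<open>a A \<equiv> -n (mod c)\<close>, and from there on only
  \<open>c = a + b\<close> and coprimality of \<open>a\<close> and \<open>b\<close> matter. The right-hand side of the formula makes sense for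
  every integer \<open>n\<close>. Passing from \<open>n\<close> to \<open>n - c\<close> keeps \<open>A\<close> and shifts \<open>B\<close> and \<open>C\<close> by one, so the
  difference of the two values is the Popoviciu count of the solutions of \<open>a x + b y = n\<close>, that is,
  of the solutions with \<open>z = 0\<close>. For \<open>-c < n < 0\<close> one has \<open>n = ab - aC - bB\<close> and \<open>A = C - B + a\<close>, and
  the right-hand side vanishes identically; for \<open>n = -c\<close> it vanishes as well, with \<open>B = C = 1\<close> and
  \<open>A = c\<close>.\<close>

section \<open>Linear equations in two unknowns\<close>

text \<open>Both \<open>a\<close> and \<open>b\<close> divide \<open>n + a * C + b * B\<close>, so
  by coprimality their product does. For \<open>u \<ge> 1\<close> the quotient \<open>u\<close>
  exceeds the number of solutions of \<open>a x + b y = n\<close> by one.\<close>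

lemma two_var_quotient:
  fixes a b B C n :: int
  assumes "coprime a b" and "[b * B = - n] (mod a)" and "[a * C = - n] (mod b)"
  obtains u where "n = a * b * u - a * C - b * B"
proof -
  have "a dvd b * B + n" "b dvd a * C + n"
    using assms(2,3) by (simp_all add: cong_iff_dvd_diff)
  then have "a dvd (b * B + n) + a * C" "b dvd (a * C + n) + b * B"
    by (auto intro: dvd_add)
  then have "a * b dvd n + a * C + b * B"
    using assms(1) by (intro divides_mult) (simp_all add: algebra_simps)
  then obtain u where "n + a * C + b * B = a * b * u" ..
  then show ?thesis
    by (intro that[of u]) linarith
qed

text \<open>Every solution has the form \<open>x + C = b j\<close>,
  \<open>y + B = a (u - j)\<close>, and nonnegativity of \<open>x\<close> and \<open>y\<close> means
  exactly \<open>1 \<le> j < u\<close>.\<close>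

lemma card_two_var_solutions:
  fixes a b B C u :: int
  assumes "a > 0" "b > 0" "coprime a b"
    and B: "1 \<le> B" "B \<le> a" and C: "1 \<le> C" "C \<le> b" and u: "u \<ge> 1"
  shows "int (card {(x :: nat, y :: nat). a * int x + b * int y = a * b * u - a * C - b * B}) = u - 1"
proof -
  let ?S = "{(x :: nat, y :: nat). a * int x + b * int y = a * b * u - a * C - b * B}"
  \<comment> \<open>Here \<open>k\<close> is \<open>j - 1\<close>; for
    \<open>0 \<le> k \<le> u - 2\<close> both arguments of \<open>nat\<close> are sums of
    nonnegative terms, so nothing is truncated.\<close>
  define f where "f k = (nat (b - C + b * k), nat (a - B + a * (u - 2 - k)))" for k :: int
  have f_simps: "int (fst (f k)) = b - C + b * k" "int (snd (f k)) = a - B + a * (u - 2 - k)"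
    if "k \<in> {0..<u - 1}" for k
    using that assms by (simp_all add: f_def)
  have "inj_on f {0..<u - 1}"
  proof (rule inj_onI)
    fix k l assume kl: "k \<in> {0..<u - 1}" "l \<in> {0..<u - 1}" "f k = f l"
    then have "b - C + b * k = b - C + b * l"
      using f_simps(1)[OF kl(1)] f_simps(1)[OF kl(2)] by metis
    then show "k = l"
      using \<open>b > 0\<close> by simp
  qed
  moreover have "f ` {0..<u - 1} = ?S"
  proof (intro equalityI subsetI)
    fix p assume "p \<in> f ` {0..<u - 1}"
    then obtain k where k: "k \<in> {0..<u - 1}" "p = f k" by blast
    have "a * int (fst (f k)) + b * int (snd (f k)) = a * b * u - a * C - b * B"
      unfolding f_simps[OF k(1)] by (simp add: algebra_simps)
    then show "p \<in> ?S"
      by (simp add: k(2) case_prod_beta)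
  next
    fix p assume "p \<in> ?S"
    then obtain x y :: nat
      where p: "p = (x, y)" and eq: "a * int x + b * int y = a * b * u - a * C - b * B" by blast
    have "a * (int x + C) = b * (a * u - B - int y)"
      using eq by (simp add: algebra_simps)
    then have "b dvd a * (int x + C)" by simp
    then have "b dvd int x + C"
      using \<open>coprime a b\<close> by (simp add: coprime_commute coprime_dvd_mult_right_iff)
    then obtain j where j: "int x + C = b * j" ..
    have "b * (int y + B) = b * (a * (u - j))"
    proof -
      have "b * (int y + B) = a * (b * u - (int x + C))"
        using eq by (simp add: algebra_simps)
      then show ?thesis unfolding j by (simp add: algebra_simps)
    qed
    then have y: "int y + B = a * (u - j)"
      using \<open>b > 0\<close> by simp
    have "b * j > 0" "a * (u - j) > 0"
      using j y B C by linarith+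
    then have "j \<ge> 1" "j < u"
      using \<open>a > 0\<close> \<open>b > 0\<close> by (simp_all add: zero_less_mult_iff)
    then have k: "j - 1 \<in> {0..<u - 1}" by simp
    have "int (fst (f (j - 1))) = int x" "int (snd (f (j - 1))) = int y"
      unfolding f_simps[OF k] using j y by (simp_all add: algebra_simps)
    then have "f (j - 1) = p"
      by (simp add: p prod_eq_iff)
    then show "p \<in> f ` {0..<u - 1}"
      using k by blast
  qed
  ultimately have "card ?S = card {0..<u - 1}"
    by (metis card_image)
  then show ?thesis using u by simp
qed

section \<open>Counting with three unknowns\<close>

text \<open>Split by \<open>z = 0\<close> or \<open>z = Suc w\<close>. As \<open>n\<close> is an
  integer, the recursion may run below zero, where the sets are empty.\<close>

lemma card_three_var_solutions_rec:
  fixes a b c n :: int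
  assumes "a > 0" "b > 0" "c > 0"
  shows "card {(x :: nat, y :: nat, z :: nat). a * int x + b * int y + c * int z = n} =
    card {(x :: nat, y :: nat). a * int x + b * int y = n} +
    card {(x :: nat, y :: nat, z :: nat). a * int x + b * int y + c * int z = n - c}"
proof -
  let ?T = "\<lambda>n. {(x :: nat, y :: nat, z :: nat). a * int x + b * int y + c * int z = n}"
  let ?S = "{(x :: nat, y :: nat). a * int x + b * int y = n}"
  let ?f = "\<lambda>(x :: nat, y :: nat). (x, y, 0 :: nat)" and ?g = "\<lambda>(x :: nat, y :: nat, z :: nat). (x, y, Suc z)"
  have fin: "finite (?T m)" for m
  proof -
    have "?T m \<subseteq> {(x, y, z). nat a * x + nat b * y + nat c * z = nat m}"
    proof clarify
      fix x y z :: nat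
      have "int (nat a * x + nat b * y + nat c * z) = a * int x + b * int y + c * int z"
        using assms by simp
      then show "nat a * x + nat b * y + nat c * z = nat (a * int x + b * int y + c * int z)"
        by linarith
    qed
    then show ?thesis
      by (rule finite_subset) (use assms in \<open>simp add: finite_solutions\<close>)
  qed
  have inj: "inj_on ?f ?S" "inj_on ?g (?T (n - c))"
    by (auto simp: inj_on_def)
  have eq: "?T n = ?f ` ?S \<union> ?g ` ?T (n - c)"
  proof (intro equalityI subsetI)
    fix p assume "p \<in> ?T n"
    then obtain x y z where p: "p = (x, y, z)" "a * int x + b * int y + c * int z = n" by blast
    show "p \<in> ?f ` ?S \<union> ?g ` ?T (n - c)"
    proof (cases z)
      case 0
      then show ?thesis using p by (auto simp: image_iff)
    next
      case (Suc w)
      then have "(x, y, w) \<in> ?T (n - c)" using p by (simp add: algebra_simps)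
      then have "?g (x, y, w) \<in> ?g ` ?T (n - c)" by (rule imageI)
      then show ?thesis using p Suc by simp
    qed
  qed (auto simp: algebra_simps)
  then have "finite (?f ` ?S)" "finite (?g ` ?T (n - c))"
    using fin[of n] by simp_all
  moreover have "?f ` ?S \<inter> ?g ` ?T (n - c) = {}" by auto
  ultimately have "card (?T n) = card (?f ` ?S) + card (?g ` ?T (n - c))"
    unfolding eq by (rule card_Un_disjoint)
  then show ?thesis
    by (simp only: card_image[OF inj(1)] card_image[OF inj(2)])
qed

text \<open>Multiplying by \<open>2 * a * b * c\<close> leaves polynomial identities over the
  integers. The bound \<open>n \<ge> - c\<close> is just what one step down from
  \<open>n \<ge> 0\<close> can reach.\<close>

lemma card_three_var_solutions:
  fixes a b c n A B C :: int
  assumes "a > 0" "b > 0" "coprime a b" and c: "c = a + b" and "n \<ge> - c"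
    and "1 \<le> B" "B \<le> a" "[b * B = - n] (mod a)"
    and "1 \<le> C" "C \<le> b" "[a * C = - n] (mod b)"
    and "1 \<le> A" "A \<le> c" "[a * A = - n] (mod c)"
  shows "2 * a * b * c * int (card {(x :: nat, y :: nat, z :: nat). a * int x + b * int y + c * int z = n}) =
    n * (n + a + b + c) + c * b * B * (a + 1 - (B - 1)) + a * c * C * (b + 1 - (C - 1))
    + b * a * A * (c + 1 - (c - 1) * (A - 1)) + a * b * c * ((A - 1) * (A - 2) - 4)"
  using assms(5-)
proof (induction "nat (n + c)" arbitrary: n B C rule: less_induct)
  case less
  note n = \<open>n \<ge> - c\<close> and B = \<open>1 \<le> B\<close> \<open>B \<le> a\<close> \<open>[b * B = - n] (mod a)\<close>
    and C = \<open>1 \<le> C\<close> \<open>C \<le> b\<close> \<open>[a * C = - n] (mod b)\<close>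
    and A = \<open>1 \<le> A\<close> \<open>A \<le> c\<close> \<open>[a * A = - n] (mod c)\<close>
  let ?T = "\<lambda>n. {(x :: nat, y :: nat, z :: nat). a * int x + b * int y + c * int z = n}"
  obtain u where u: "n = a * b * u - a * C - b * B"
    using two_var_quotient[OF \<open>coprime a b\<close> B(3) C(3)] .
  have ab: "a * b > 0" using \<open>a > 0\<close> \<open>b > 0\<close> by simp
  have CB: "a * C \<ge> a" "b * B \<ge> b" "a * C \<le> a * b" "b * B \<le> a * b"
    using \<open>a > 0\<close> \<open>b > 0\<close> B C by (simp_all add: mult.commute)
  have "coprime c a"
    using \<open>coprime a b\<close> by (simp add: c coprime_iff_gcd_eq_1 gcd.commute[of _ a])
  have "c dvd a * A + n"
    using A(3) by (simp add: cong_iff_dvd_diff)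
  show ?case
  proof (cases "n < 0")
    case True
    have "a * int x + b * int y + c * int z \<noteq> n" for x y z :: nat
    proof -
      have "a * int x + b * int y + c * int z \<ge> 0"
        using \<open>a > 0\<close> \<open>b > 0\<close> c by simp
      then show ?thesis using True by linarith
    qed
    then have "?T n = {}" by auto
    then have card0: "card (?T n) = 0" by (simp only: card.empty)
    \<comment> \<open>\<open>a * b * u = n + a * C + b * B\<close> lies between
      \<open>- c + a + b = 0\<close> and \<open>2 * a * b\<close>, the latter excluded.\<close>
    have "a * b * u < a * b * 2" "a * b * u \<ge> 0"
      using True u n c CB by linarith+
    then have "u < 2" "u \<ge> 0"
      using ab by (simp_all add: mult_less_cancel_left_pos zero_le_mult_iff)
    then consider "u = 0" | "u = 1" by linarith
    then show ?thesis
    proof cases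
      case 1
      have "n = - (a * C) - b * B"
        using u 1 by simp
      then have "a * C = a" "b * B = b"
        using n c CB by linarith+
      then have C1: "C = 1" and B1: "B = 1"
        using \<open>a > 0\<close> \<open>b > 0\<close> by simp_all
      have n_eq: "n = - c"
        using u by (simp add: 1 C1 B1 c)
      then have "c dvd a * A"
        using dvd_add[OF \<open>c dvd a * A + n\<close> dvd_refl] by simp
      then have "c dvd A"
        using \<open>coprime c a\<close> by (simp add: coprime_dvd_mult_right_iff)
      then have "A = c"
        using A(1,2) zdvd_imp_le[of c A] by simp
      then show ?thesis
        unfolding card0 by (simp add: n_eq C1 B1 c algebra_simps)
    next
      case 2
      have n_eq: "n = a * b - a * C - b * B"
        using u 2 by simp
      \<comment> \<open>This multiple of \<open>c\<close> trades \<open>b\<close> for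
        \<open>- a\<close>, so that \<open>a\<close> factors out and can be cancelled modulo
        \<open>c\<close>.\<close>
      have "c dvd (a * A + n) + c * (B - a)"
        using \<open>c dvd a * A + n\<close> by simp
      moreover have "(a * A + n) + c * (B - a) = a * (A - (C - B + a))"
        by (simp add: n_eq c algebra_simps)
      ultimately have "c dvd A - (C - B + a)"
        using \<open>coprime c a\<close> by (simp add: coprime_dvd_mult_right_iff)
      \<comment> \<open>Both \<open>A\<close> and \<open>C - B + a\<close> lie between
        \<open>1\<close> and \<open>c\<close>.\<close>
      moreover have "\<bar>A - (C - B + a)\<bar> < c"
        using A B C c by linarith
      ultimately have A_eq: "A = C - B + a"
        using zdvd_not_zless[of "\<bar>A - (C - B + a)\<bar>" c] by (cases "A - (C - B + a) = 0") auto
      show ?thesis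
        unfolding card0 by (simp add: n_eq A_eq c algebra_simps)
    qed
  next
    case False
    have "a * b * u > 0"
      using False u \<open>a > 0\<close> \<open>b > 0\<close> CB by linarith
    then have u1: "u \<ge> 1"
      using ab by (simp add: zero_less_mult_iff)
    \<comment> \<open>Since \<open>c\<close> is congruent to \<open>b\<close> modulo
      \<open>a\<close> and to \<open>a\<close> modulo \<open>b\<close>, the residues for
      \<open>n - c\<close> are \<open>B + 1\<close> and \<open>C + 1\<close>, brought back into
      range.\<close>
    define B' where "B' = (if B = a then 1 else B + 1)"
    define C' where "C' = (if C = b then 1 else C + 1)"
    have "[B' = B + 1] (mod a)" "[C' = C + 1] (mod b)"
      by (auto simp: B'_def C'_def cong_iff_dvd_diff)
    then have "[b * B' = b * (B + 1)] (mod a)" "[a * C' = a * (C + 1)] (mod b)"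
      by (auto intro: cong_scalar_left)
    moreover have "[b * (B + 1) = - (n - c)] (mod a)"
    proof -
      have "a dvd (b * B + n) - a"
        using B(3) by (simp add: cong_iff_dvd_diff)
      then show ?thesis by (simp add: cong_iff_dvd_diff c algebra_simps)
    qed
    moreover have "[a * (C + 1) = - (n - c)] (mod b)"
    proof -
      have "b dvd (a * C + n) - b"
        using C(3) by (simp add: cong_iff_dvd_diff)
      then show ?thesis by (simp add: cong_iff_dvd_diff c algebra_simps)
    qed
    ultimately have cong: "[b * B' = - (n - c)] (mod a)" "[a * C' = - (n - c)] (mod b)"
      by (blast intro: cong_trans)+
    have A': "[a * A = - (n - c)] (mod c)"
    proof -
      have "c dvd (a * A + n) - c"
        using A(3) by (simp add: cong_iff_dvd_diff)
      then show ?thesis by (simp add: cong_iff_dvd_diff algebra_simps)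
    qed
    have IH: "2 * a * b * c * int (card (?T (n - c))) =
      (n - c) * ((n - c) + a + b + c) + c * b * B' * (a + 1 - (B' - 1))
      + a * c * C' * (b + 1 - (C' - 1))
      + b * a * A * (c + 1 - (c - 1) * (A - 1)) + a * b * c * ((A - 1) * (A - 2) - 4)"
      using False \<open>a > 0\<close> \<open>b > 0\<close> B C A c
      by (intro less.hyps cong A') (auto simp: B'_def C'_def)
    \<comment> \<open>\<open>B (a + 2 - B)\<close> takes the same value at \<open>1\<close> and at \<open>a + 1\<close>, so the wrap-around is invisible.\<close>
    have shift: "B' * (a + 1 - (B' - 1)) = (B + 1) * (a + 1 - B)"
      "C' * (b + 1 - (C' - 1)) = (C + 1) * (b + 1 - C)"
      by (auto simp: B'_def C'_def)
    have "int (card (?T n)) = (u - 1) + int (card (?T (n - c)))"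
      using card_three_var_solutions_rec[of a b c n] \<open>a > 0\<close> \<open>b > 0\<close> c
        card_two_var_solutions[OF \<open>a > 0\<close> \<open>b > 0\<close> \<open>coprime a b\<close> B(1,2) C(1,2) u1] u
      by simp
    then have "2 * a * b * c * int (card (?T n)) =
        2 * a * b * c * (u - 1) + 2 * a * b * c * int (card (?T (n - c)))"
      by (simp only: distrib_left)
    also have "\<dots> = 2 * a * b * c * (u - 1) + ((n - c) * ((n - c) + a + b + c)
      + c * b * ((B + 1) * (a + 1 - B)) + a * c * ((C + 1) * (b + 1 - C))
      + b * a * A * (c + 1 - (c - 1) * (A - 1)) + a * b * c * ((A - 1) * (A - 2) - 4))"
      unfolding IH by (simp only: mult.assoc shift)
    also have "\<dots> = n * (n + a + b + c) + c * b * B * (a + 1 - (B - 1))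
      + a * c * C * (b + 1 - (C - 1))
      + b * a * A * (c + 1 - (c - 1) * (A - 1)) + a * b * c * ((A - 1) * (A - 2) - 4)"
      unfolding u c by (simp add: algebra_simps)
    finally show ?thesis .
  qed
qed

section \<open>Fibonacci identities and the residues\<close>

lemma fib_int_minus_2: "fib_int (int i - 2) = 2 * int (fib i) - int (fib (i + 1))"
proof -
  have "fib_int (int i + 1) = fib_int (int i) + fib_int (int i - 1)"
    "fib_int (int i - 1 + 1) = fib_int (int i - 1) + fib_int (int i - 1 - 1)"
    by (rule fib_int_rec)+
  moreover have "fib_int (int i + 1) = int (fib (i + 1))"
    using fib_int_of_nat[of "i + 1"] by (simp only: of_nat_add of_nat_1)
  ultimately show ?thesis by simp
qed

text \<open>Cassini's identity in two consecutive terms: the form \<open>b^2 - a b - a^2\<close>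
  changes sign under \<open>(a, b) \<mapsto> (b, a + b)\<close>.\<close>

lemma fib_quadratic_form:
  "int (fib (i + 1)) ^ 2 - int (fib i) * int (fib (i + 1)) - int (fib i) ^ 2 = (-1) ^ i"
  by (induction i) (simp_all add: power2_eq_square algebra_simps)

text \<open>Converts the explicit residues into linear congruences: \<open>- s * w\<close> is an
  inverse of \<open>k\<close> modulo \<open>m\<close>.\<close>

lemma cong_mult_signed_residue:
  fixes m s n w X k :: int
  assumes "[X = s * n * w] (mod m)" and "s * s = 1" and "[k * w = - s] (mod m)"
  shows "[k * X = - n] (mod m)"
proof -
  have "[k * X = k * (s * n * w)] (mod m)"
    using assms(1) by (rule cong_scalar_left)
  also have "k * (s * n * w) = s * n * (k * w)" by simp
  also have "[s * n * (k * w) = s * n * (- s)] (mod m)"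
    using assms(3) by (rule cong_scalar_left)
  also have "s * n * (- s) = - (n * (s * s))" by simp
  also have "\<dots> = - n" using assms(2) by simp
  finally show ?thesis .
qed

theorem theorem4:
  fixes i n :: nat and B1 C2 A3 N2 :: int
  assumes "i \<ge> 1" and "n \<ge> 1"
    and "[B1 = (-1) ^ i * int n * fib_int (int i - 2)] (mod int (fib i))"
    and "1 \<le> B1" and "B1 \<le> int (fib i)"
    and "[C2 = (-1) ^ i * int n * int (fib i)] (mod int (fib (i + 1)))"
    and "1 \<le> C2" and "C2 \<le> int (fib (i + 1))"
    and "[A3 = (-1) ^ i * int n * int (fib (i + 1))] (mod int (fib (i + 2)))"
    and "1 \<le> A3" and "A3 \<le> int (fib (i + 2))"
    and "N2 =
        int n * (int n + int (fib i) + int (fib (i + 1)) + int (fib (i + 2)))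
      + int (fib (i + 2)) * int (fib (i + 1)) * B1 * (int (fib i) + 1 - (B1 - 1))
      + int (fib i) * int (fib (i + 2)) * C2 * (int (fib (i + 1)) + 1 - (C2 - 1))
      + int (fib (i + 1)) * int (fib i) * A3
          * (int (fib (i + 2)) + 1 - (int (fib (i + 2)) - 1) * (A3 - 1))"
  shows "real (num_solutions (fib i) (fib (i + 1)) (fib (i + 2)) n) =
      real_of_int N2 / (2 * real (fib i) * real (fib (i + 1)) * real (fib (i + 2)))
      + (real_of_int A3 - 1) * (real_of_int A3 - 2) / 2 - 2"
proof -
  define a b c s :: int
    where "a = int (fib i)" and "b = int (fib (i + 1))" and "c = int (fib (i + 2))" and "s = (-1) ^ i"
  define M where "M = num_solutions (fib i) (fib (i + 1)) (fib (i + 2)) n"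
  note abc_fold = a_def[symmetric] b_def[symmetric] c_def[symmetric] s_def[symmetric]
  note asm = assms(3-)[unfolded abc_fold fib_int_minus_2]
  have pos: "a > 0" "b > 0"
    using fib_neq_0_nat[of i] fib_neq_0_nat[of "i + 1"] \<open>i \<ge> 1\<close> by (simp_all add: a_def b_def)
  have c: "c = a + b"
    by (simp add: a_def b_def c_def)
  then have "c > 0"
    using pos by simp
  have cop: "coprime a b"
    using coprime_fib_Suc_nat[of i] by (simp add: a_def b_def)
  have ss: "s * s = 1"
    by (simp add: s_def flip: power_add)
  have s_eq: "s = b ^ 2 - a * b - a ^ 2"
    using fib_quadratic_form[of i] by (simp add: a_def b_def s_def)
  have congs: "[b * (2 * a - b) = - s] (mod a)" "[a * a = - s] (mod b)" "[a * b = - s] (mod c)"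
  proof -
    \<comment> \<open>After substituting \<open>s_eq\<close>, all three differences share the
      cofactor \<open>b - a\<close>; the last one is \<open>b^2 - a^2\<close>.\<close>
    have "b * (2 * a - b) - (- s) = a * (b - a)" "a * a - (- s) = b * (b - a)"
      "a * b - (- s) = c * (b - a)"
      by (simp_all add: s_eq c power2_eq_square algebra_simps)
    then show "[b * (2 * a - b) = - s] (mod a)" "[a * a = - s] (mod b)" "[a * b = - s] (mod c)"
      by (simp_all only: cong_iff_dvd_diff dvd_triv_left)
  qed
  have "{(x, y, z). fib i * x + fib (i + 1) * y + fib (i + 2) * z = n} =
      {(x, y, z). a * int x + b * int y + c * int z = int n}"
    unfolding a_def b_def c_def of_nat_mult[symmetric] of_nat_add[symmetric] of_nat_eq_iff ..
  then have M: "M = card {(x, y, z). a * int x + b * int y + c * int z = int n}"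
    by (simp add: M_def num_solutions_def)
  \<comment> \<open>Dividing by \<open>2 * a * b * c\<close> turns the summand after
    \<open>N2\<close> into \<open>(A3 - 1) * (A3 - 2) / 2 - 2\<close>.\<close>
  have "2 * a * b * c * int M = N2 + a * b * c * ((A3 - 1) * (A3 - 2) - 4)"
    unfolding M asm(10)
    by (rule card_three_var_solutions[OF pos cop c _ asm(2,3) _ asm(5,6) _ asm(8,9)])
      (use pos c cong_mult_signed_residue[OF asm(1) ss congs(1)]
         cong_mult_signed_residue[OF asm(4) ss congs(2)]
         cong_mult_signed_residue[OF asm(7) ss congs(3)] in auto)
  then have "real_of_int (2 * a * b * c * int M) =
      real_of_int (N2 + a * b * c * ((A3 - 1) * (A3 - 2) - 4))"
    by simp
  then have "real M = real_of_int N2 / (2 * real_of_int a * real_of_int b * real_of_int c)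
      + (real_of_int A3 - 1) * (real_of_int A3 - 2) / 2 - 2"
    using pos \<open>c > 0\<close> by (simp add: field_simps)
  then show ?thesis
    by (simp add: M_def a_def b_def c_def)
qed

end
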